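(* Let $(S,\cdot)$ be a commutative adequate partial semigroup and let $A\subseteq S$. The set $A$ is quasi-central if and only if there exist a dynamical system $(X,\langle T_s\rangle_{s\in S})$, points $x$ and $y$ in $X$, and a neighbourhood $U$ of $y$ such that the pair $(x,y)$ is jointly intermittently uniformly recurrent and $A=\{s\in S: T_s(x)\in U\}$.
   Context: A partial semigroup is a pair $(S,\cdot)$ where $\cdot$ maps a subset of $S\times S$ to $S$ and for all $a,b,c\in S$, $(a\cdot b)\cdot c=a\cdot(b\cdot c)$ in the sense that if either side is defined, then so is the other and they are equal. It is commutative if $a\cdot b=b\cdot a$ holds for every pair $(a,b)$ in the domain of the operation. For $s\in S$, $\phi(s)=\{t\in S: s\cdot t \text{ is defined}\}$; for a nonempty finite $H\subseteq S$, $\sigma(H)=\bigcap_{s\in H}\phi(s)$. $S$ is adequate if $\sigma(H)\neq\emptyset$ for every nonempty finite $H\subseteq S$. $\beta S$ is the Stone-Čech compactification of the discrete space $S$ (the set of ultrafilters on $S$ with basic clopen sets $\overline{A}=\{p\in\beta S: A\in p\}$). $\delta S=\bigcap_{x\in S}cl_{\beta S}(\phi(x))$. For $x\in S$, $A\subseteq S$: $x^{-1}A=\{y\in\phi(x): x\cdot y\in A\}$. For $p\in\beta S$, $q\in\delta S$, $p\cdot q$ is the ultrafilter with $A\in p\cdot q\iff\{x\in S: x^{-1}A\in q\}\in p$. With this operation $\delta S$ is a compact Hausdorff right topological semigroup; $K(\delta S)$ denotes its smallest two-sided ideal and $cl\,K(\delta S)$ its closure. $A\subseteq S$ is quasi-central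 if and only if there is an idempotent $p$ in $cl\,K(\delta S)$ such that $A\in p$. $A\subseteq S$ is piecewise syndetic if and only if $\overline{A}\cap K(\delta S)\neq\emptyset$. A dynamical system (for $S$) is a pair $(X,\langle T_s\rangle_{s\in S})$ such that $X$ is a compact Hausdorff space, each $T_s:X\to X$ is continuous, and for all $s,t\in S$, $T_s\circ T_t=T_{st}$ whenever $t\in\phi(s)$. The pair $(x,y)$ of points of $X$ is jointly intermittently uniformly recurrent if and only if for every neighbourhood $U$ of $y$, the set $\{s\in S: T_s(x)\in U\text{ and }T_s(y)\in U\}$ is piecewise syndetic. *)

theory Defs
  imports "HOL-Analysis.Analysis"
begin

(* A partial operation on the set S, taken to be the type 's: "m a b = None" means that
   the product of a and b is undefined. *)
type_synonym 's partial_op = "'s \<Rightarrow> 's \<Rightarrow> 's option"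

(* Both sides of the equation below are Some exactly when the corresponding iterated product is
   defined, so the equation says that if one side is defined then so is the other, with equal
   values. *)
definition partial_semigroup :: "'s partial_op \<Rightarrow> bool" where
  "partial_semigroup m \<longleftrightarrow>
     (\<forall>a b c. Option.bind (m a b) (\<lambda>u. m u c) = Option.bind (m b c) (\<lambda>v. m a v))"

definition commutative_op :: "'s partial_op \<Rightarrow> bool" where
  "commutative_op m \<longleftrightarrow> (\<forall>a b. m a b \<noteq> None \<longrightarrow> m a b = m b a)"

definition phi :: "'s partial_op \<Rightarrow> 's \<Rightarrow> 's set" where
  "phi m s = {t. m s t \<noteq> None}"

definition sigma :: "'s partial_op \<Rightarrow> 's set \<Rightarrow> 's set" where
  "sigma m H = (\<Inter>s\<in>H. phi m s)"

definition adequate :: "'s partial_op \<Rightarrow> bool" where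
  "adequate m \<longleftrightarrow> (\<forall>H. finite H \<and> H \<noteq> {} \<longrightarrow> sigma m H \<noteq> {})"

definition ultrafilter :: "'s set set \<Rightarrow> bool" where
  "ultrafilter p \<longleftrightarrow>
     {} \<notin> p \<and> UNIV \<in> p \<and>
     (\<forall>A B. A \<in> p \<and> B \<in> p \<longrightarrow> A \<inter> B \<in> p) \<and>
     (\<forall>A B. A \<in> p \<and> A \<subseteq> B \<longrightarrow> B \<in> p) \<and>
     (\<forall>A. A \<in> p \<or> - A \<in> p)"

definition basic_clopen :: "'s set \<Rightarrow> 's set set set" where
  "basic_clopen A = {p. ultrafilter p \<and> A \<in> p}"

definition beta :: "'s set set topology" where
  "beta = topology_generated_by (range basic_clopen)"

(* The canonical embedding of S into its Stone-Cech compactification. *)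
definition principal :: "'s \<Rightarrow> 's set set" where
  "principal s = {A. s \<in> A}"

definition delta :: "'s partial_op \<Rightarrow> 's set set set" where
  "delta m = (\<Inter>x. beta closure_of (principal ` phi m x))"

definition preimage_op :: "'s partial_op \<Rightarrow> 's \<Rightarrow> 's set \<Rightarrow> 's set" where
  "preimage_op m x A = {y \<in> phi m x. the (m x y) \<in> A}"

(* Only meaningful for p in beta S and q in delta S. *)
definition uf_mult :: "'s partial_op \<Rightarrow> 's set set \<Rightarrow> 's set set \<Rightarrow> 's set set" where
  "uf_mult m p q = {A. {x. preimage_op m x A \<in> q} \<in> p}"

definition two_sided_ideal :: "'s partial_op \<Rightarrow> 's set set set \<Rightarrow> bool" where
  "two_sided_ideal m I \<longleftrightarrow>
     I \<noteq> {} \<and> I \<subseteq> delta m \<and>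
     (\<forall>p\<in>I. \<forall>q\<in>delta m. uf_mult m p q \<in> I \<and> uf_mult m q p \<in> I)"

(* LEAST refers to the inclusion order on subsets of delta S. *)
definition smallest_ideal :: "'s partial_op \<Rightarrow> 's set set set" where
  "smallest_ideal m = (LEAST I. two_sided_ideal m I)"

definition quasi_central :: "'s partial_op \<Rightarrow> 's set \<Rightarrow> bool" where
  "quasi_central m A \<longleftrightarrow>
     (\<exists>p \<in> subtopology beta (delta m) closure_of smallest_ideal m.
        uf_mult m p p = p \<and> A \<in> p)"

definition piecewise_syndetic :: "'s partial_op \<Rightarrow> 's set \<Rightarrow> bool" where
  "piecewise_syndetic m A \<longleftrightarrow> basic_clopen A \<inter> smallest_ideal m \<noteq> {}"

definition dynamical_system :: "'s partial_op \<Rightarrow> 'x topology \<Rightarrow> ('s \<Rightarrow> 'x \<Rightarrow> 'x) \<Rightarrow> bool" where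
  "dynamical_system m X T \<longleftrightarrow>
     compact_space X \<and> Hausdorff_space X \<and>
     (\<forall>s. continuous_map X X (T s)) \<and>
     (\<forall>s t. t \<in> phi m s \<longrightarrow> (\<forall>z\<in>topspace X. T s (T t z) = T (the (m s t)) z))"

(* Neighbourhoods need not be open. *)
definition neighbourhood :: "'x topology \<Rightarrow> 'x \<Rightarrow> 'x set \<Rightarrow> bool" where
  "neighbourhood X y U \<longleftrightarrow> U \<subseteq> topspace X \<and> (\<exists>V. openin X V \<and> y \<in> V \<and> V \<subseteq> U)"

definition jointly_intermittently_uniformly_recurrent ::
    "'s partial_op \<Rightarrow> 'x topology \<Rightarrow> ('s \<Rightarrow> 'x \<Rightarrow> 'x) \<Rightarrow> 'x \<Rightarrow> 'x \<Rightarrow> bool" where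
  "jointly_intermittently_uniformly_recurrent m X T x y \<longleftrightarrow>
     (\<forall>U. neighbourhood X y U \<longrightarrow> piecewise_syndetic m {s. T s x \<in> U \<and> T s y \<in> U})"

end

theory Submission
  imports Defs
begin

text \<open>If \<open>(x, y)\<close> is jointly intermittently uniformly recurrent, then by compactness some
  \<open>p \<in> cl K(\<delta>S)\<close> satisfies \<open>p-lim T\<^sub>s x = y\<close> and \<open>p-lim T\<^sub>s y = y\<close>. The set of all such \<open>p\<close> is a
  closed subsemigroup because \<open>cl K(\<delta>S)\<close> is a right ideal, so it contains an idempotent. Conversely,
  given an idempotent \<open>p \<in> cl K(\<delta>S)\<close> with \<open>A \<in> p\<close>, adjoin an identity \<open>e\<close> to \<open>S\<close>, let \<open>S\<close> act on
  0-1 sequences indexed by \<open>S \<union> {e}\<close> by right translation of the coordinates, and take for \<open>x\<close> the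
  characteristic function of \<open>A\<close>, \<open>y = p-lim T\<^sub>s x\<close>, and \<open>U\<close> the clopen set of sequences with value 1
  at \<open>e\<close>. Idempotency of \<open>p\<close> gives \<open>p-lim T\<^sub>s y = y\<close>.\<close>

section \<open>Compactness and minimal closed sets\<close>

text \<open>Directedness puts a member of the family inside every finite intersection, so the finite
  intersection property holds; \<open>ne\<close> covers the empty subfamily.\<close>

lemma compact_space_Inter_directed_nonempty:
  assumes X: "compact_space X" and ne: "\<C> \<noteq> {}"
    and cl: "\<And>C. C \<in> \<C> \<Longrightarrow> closedin X C \<and> C \<noteq> {}"
    and dir: "\<And>C D. \<lbrakk>C \<in> \<C>; D \<in> \<C>\<rbrakk> \<Longrightarrow> \<exists>E\<in>\<C>. E \<subseteq> C \<inter> D"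
  shows "\<Inter>\<C> \<noteq> {}"
proof -
  have "\<exists>E\<in>\<C>. E \<subseteq> \<Inter>\<F>" if "finite \<F>" "\<F> \<subseteq> \<C>" for \<F>
    using that
  proof (induction \<F> rule: finite_induct)
    case empty
    then show ?case using ne by auto
  next
    case (insert C \<F>)
    then obtain E where "E \<in> \<C>" "E \<subseteq> \<Inter>\<F>" by auto
    with insert.prems dir[of C E] show ?case by (metis Inter_insert insert_subset le_inf_iff subset_trans)
  qed
  then have "\<Inter>\<F> \<noteq> {}" if "finite \<F>" "\<F> \<subseteq> \<C>" for \<F>
    using that cl by (metis subset_empty)
  with X cl show ?thesis
    unfolding compact_space_fip by blast
qed

text \<open>Zorn's lemma, with compactness keeping intersections of chains nonempty.
  \<open>P\<close> stays abstract so that the result serves closed subsemigroups and closed left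
  ideals alike.\<close>

lemma compact_space_minimal_closedin:
  assumes X: "compact_space X" and C: "closedin X C" "C \<noteq> {}" "P C"
    and Inter: "\<forall>\<D>. \<D> \<noteq> {} \<and> (\<forall>D\<in>\<D>. closedin X D \<and> P D) \<longrightarrow> P (\<Inter>\<D>)"
  shows "\<exists>M\<subseteq>C. closedin X M \<and> M \<noteq> {} \<and> P M \<and>
    (\<forall>N. closedin X N \<and> N \<noteq> {} \<and> P N \<and> N \<subseteq> M \<longrightarrow> N = M)"
proof -
  define \<A> where "\<A> = {D. D \<subseteq> C \<and> closedin X D \<and> D \<noteq> {} \<and> P D}"
  \<comment> \<open>Complements reverse inclusion, so a minimal set is found by the maximal form of
    Zorn's lemma.\<close>
  have "\<exists>M\<in>uminus ` \<A>. \<forall>N\<in>uminus ` \<A>. M \<subseteq> N \<longrightarrow> N = M"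
  proof (rule subset_Zorn_nonempty)
    show "uminus ` \<A> \<noteq> {}" using C unfolding \<A>_def by auto
    fix \<C> assume ne: "\<C> \<noteq> {}" and "subset.chain (uminus ` \<A>) \<C>"
    then have sub: "\<C> \<subseteq> uminus ` \<A>" and ch: "\<And>D E. \<lbrakk>D \<in> \<C>; E \<in> \<C>\<rbrakk> \<Longrightarrow> D \<subseteq> E \<or> E \<subseteq> D"
      by (auto simp: subset_chain_def)
    define \<D> where "\<D> = uminus ` \<C>"
    have D: "\<D> \<noteq> {}" "\<D> \<subseteq> \<A>" using ne sub unfolding \<D>_def by auto
    have "\<Inter>\<D> \<noteq> {}"
    proof (rule compact_space_Inter_directed_nonempty[OF X D(1)])
      show "closedin X E \<and> E \<noteq> {}" if "E \<in> \<D>" for E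
        using that D(2) unfolding \<A>_def by auto
      show "\<exists>G\<in>\<D>. G \<subseteq> E \<inter> F" if EF: "E \<in> \<D>" "F \<in> \<D>" for E F
      proof -
        obtain E' F' where EF': "E = - E'" "F = - F'" "E' \<in> \<C>" "F' \<in> \<C>"
          using EF unfolding \<D>_def by auto
        with ch[of E' F'] have "E \<subseteq> F \<or> F \<subseteq> E" by auto
        with EF show ?thesis by auto
      qed
    qed
    moreover have "closedin X (\<Inter>\<D>)" "P (\<Inter>\<D>)" "\<Inter>\<D> \<subseteq> C"
      using D Inter unfolding \<A>_def by (auto intro!: closedin_Inter)
    ultimately have "\<Inter>\<D> \<in> \<A>" unfolding \<A>_def by auto
    moreover have "\<Union>\<C> = - \<Inter>\<D>" unfolding \<D>_def by auto
    ultimately show "\<Union>\<C> \<in> uminus ` \<A>" by blast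
  qed
  then obtain M where M: "M \<in> \<A>" "\<And>N. \<lbrakk>N \<in> \<A>; N \<subseteq> M\<rbrakk> \<Longrightarrow> N = M" by auto
  have "N = M" if "closedin X N" "N \<noteq> {}" "P N" "N \<subseteq> M" for N
    using that M unfolding \<A>_def by blast
  with M(1) show ?thesis unfolding \<A>_def by blast
qed

section \<open>Compact right topological semigroups\<close>

locale compact_right_topological_semigroup =
  fixes X :: "'a topology" and mult :: "'a \<Rightarrow> 'a \<Rightarrow> 'a" (infixl "\<odot>" 70)
  assumes compact: "compact_space X" and Hausdorff: "Hausdorff_space X"
    and nonempty: "topspace X \<noteq> {}"
    and assoc: "\<lbrakk>p \<in> topspace X; q \<in> topspace X; r \<in> topspace X\<rbrakk> \<Longrightarrow> p \<odot> q \<odot> r = p \<odot> (q \<odot> r)"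
    and continuous: "q \<in> topspace X \<Longrightarrow> continuous_map X X (\<lambda>p. p \<odot> q)"
begin

lemma mult_closed: "\<lbrakk>p \<in> topspace X; q \<in> topspace X\<rbrakk> \<Longrightarrow> p \<odot> q \<in> topspace X"
  using continuous[of q] by (auto simp: continuous_map_def)

lemma closedin_translate:
  assumes "closedin X C" "q \<in> topspace X"
  shows "closedin X ((\<lambda>p. p \<odot> q) ` C)"
  using assms compact Hausdorff continuous[of q]
  by (meson closedin_compact_space compactin_imp_closedin image_compactin)

text \<open>The Ellis-Numakura argument: for \<open>e\<close> in a minimal closed subsemigroup
  \<open>M\<close>, first \<open>M e\<close> and then the set of \<open>p\<close> in
  \<open>M\<close> with \<open>p e = e\<close> is a closed subsemigroup inside \<open>M\<close>,
  hence all of \<open>M\<close>.\<close>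

lemma exists_idempotent:
  assumes C: "closedin X C" "C \<noteq> {}" and sub: "\<And>p q. \<lbrakk>p \<in> C; q \<in> C\<rbrakk> \<Longrightarrow> p \<odot> q \<in> C"
  obtains e where "e \<in> C" "e \<odot> e = e"
proof -
  let ?P = "\<lambda>D. \<forall>p\<in>D. \<forall>q\<in>D. p \<odot> q \<in> D"
  have P: "?P C" using sub by blast
  have Inter: "\<forall>\<D>. \<D> \<noteq> {} \<and> (\<forall>D\<in>\<D>. closedin X D \<and> ?P D) \<longrightarrow> ?P (\<Inter>\<D>)"
    by (meson InterE InterI)
  obtain M where M: "M \<subseteq> C" "closedin X M" "M \<noteq> {}" "?P M"
    and min': "\<forall>N. closedin X N \<and> N \<noteq> {} \<and> ?P N \<and> N \<subseteq> M \<longrightarrow> N = M"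
    using compact_space_minimal_closedin[of X _ ?P, OF compact C P Inter] by (elim exE conjE) blast
  have min: "N = M" if "closedin X N" "N \<noteq> {}" "?P N" "N \<subseteq> M" for N
    using min' that by blast
  have MX: "M \<subseteq> topspace X" using M(2) by (rule closedin_subset)
  obtain e where e: "e \<in> M" using M(3) by auto
  have eX: "e \<in> topspace X" using e MX by auto
  have "(\<lambda>p. p \<odot> e) ` M = M"
  proof (rule min)
    show "\<forall>p\<in>(\<lambda>p. p \<odot> e) ` M. \<forall>q\<in>(\<lambda>p. p \<odot> e) ` M. p \<odot> q \<in> (\<lambda>p. p \<odot> e) ` M"
    proof clarify
      fix p q assume pq: "p \<in> M" "q \<in> M"
      have "p \<odot> e \<odot> (q \<odot> e) = (p \<odot> e \<odot> q) \<odot> e"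
        using pq e MX by (simp add: assoc mult_closed subset_iff)
      then show "p \<odot> e \<odot> (q \<odot> e) \<in> (\<lambda>p. p \<odot> e) ` M"
        using pq e M(4) by auto
    qed
  qed (use M e eX closedin_translate in auto)
  then obtain f where f: "f \<in> M" "f \<odot> e = e" using e by (metis image_iff)
  \<comment> \<open>This set contains \<open>f\<close>, and it is closed as the preimage of a point
    under right multiplication by \<open>e\<close>.\<close>
  have "{p \<in> M. p \<odot> e = e} = M"
  proof (rule min)
    have "closedin X {e}"
      using Hausdorff eX by (simp add: closedin_Hausdorff_sing_eq)
    then have "closedin X {p \<in> topspace X. p \<odot> e \<in> {e}}"
      using continuous[OF eX] by (rule closedin_continuous_map_preimage[rotated])
    then have "closedin X (M \<inter> {p \<in> topspace X. p \<odot> e \<in> {e}})"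
      using M(2) by blast
    moreover have "M \<inter> {p \<in> topspace X. p \<odot> e \<in> {e}} = {p \<in> M. p \<odot> e = e}"
      using MX by auto
    ultimately show "closedin X {p \<in> M. p \<odot> e = e}" by simp
    show "\<forall>p\<in>{p \<in> M. p \<odot> e = e}. \<forall>q\<in>{p \<in> M. p \<odot> e = e}. p \<odot> q \<in> {p \<in> M. p \<odot> e = e}"
      using M(4) MX assoc eX by (auto simp: subset_iff)
  qed (use f in auto)
  with e have "e \<odot> e = e" by auto
  with e M(1) that show thesis by auto
qed

definition is_ideal :: "'a set \<Rightarrow> bool" where
  "is_ideal I \<longleftrightarrow> I \<noteq> {} \<and> I \<subseteq> topspace X \<and> (\<forall>p\<in>I. \<forall>q\<in>topspace X. p \<odot> q \<in> I \<and> q \<odot> p \<in> I)"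

text \<open>If \<open>L\<close> is a minimal left ideal, the ideal \<open>L X\<close> is contained in every other one: an
  ideal \<open>I\<close> meets \<open>L\<close> in a left ideal, so it contains \<open>L\<close>.\<close>

lemma exists_least_ideal:
  obtains K where "is_ideal K" "\<And>I. is_ideal I \<Longrightarrow> K \<subseteq> I"
proof -
  let ?P = "\<lambda>D. \<forall>p\<in>D. \<forall>q\<in>topspace X. q \<odot> p \<in> D"
  have P: "?P (topspace X)" using mult_closed by blast
  have Inter: "\<forall>\<D>. \<D> \<noteq> {} \<and> (\<forall>D\<in>\<D>. closedin X D \<and> ?P D) \<longrightarrow> ?P (\<Inter>\<D>)"
    by (meson InterE InterI)
  obtain L where L: "closedin X L" "L \<noteq> {}" "?P L"
    and min': "\<forall>N. closedin X N \<and> N \<noteq> {} \<and> ?P N \<and> N \<subseteq> L \<longrightarrow> N = L"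
    using compact_space_minimal_closedin[of X _ ?P, OF compact closedin_topspace nonempty P Inter] by (elim exE conjE) blast
  have min: "N = L" if "closedin X N" "N \<noteq> {}" "?P N" "N \<subseteq> L" for N
    using min' that by blast
  have LX: "L \<subseteq> topspace X" using L(1) by (rule closedin_subset)
  \<comment> \<open>The left ideal \<open>X l\<close> is closed, so minimality among closed left
    ideals makes it fill \<open>L\<close>.\<close>
  have orbit: "(\<lambda>q. q \<odot> l) ` topspace X = L" if l: "l \<in> L" for l
  proof (rule min)
    show "closedin X ((\<lambda>q. q \<odot> l) ` topspace X)"
      using l LX by (intro closedin_translate) auto
    show "(\<lambda>q. q \<odot> l) ` topspace X \<noteq> {}" using nonempty by blast
    show "?P ((\<lambda>q. q \<odot> l) ` topspace X)"
      using l LX by (auto simp: assoc[symmetric] mult_closed subset_iff intro!: imageI)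
    show "(\<lambda>q. q \<odot> l) ` topspace X \<subseteq> L" using l L(3) by auto
  qed
  define K where "K = {l \<odot> q | l q. l \<in> L \<and> q \<in> topspace X}"
  show thesis
  proof (rule that[of K])
    show "is_ideal K"
      unfolding is_ideal_def
    proof (intro conjI ballI)
      show "K \<noteq> {}" using L(2) nonempty unfolding K_def by blast
      show "K \<subseteq> topspace X" using LX mult_closed unfolding K_def by auto
      fix p q assume "p \<in> K" and q: "q \<in> topspace X"
      then obtain l r where p: "p = l \<odot> r" "l \<in> L" "r \<in> topspace X" unfolding K_def by auto
      have lX: "l \<in> topspace X" using p LX by auto
      show "p \<odot> q \<in> K"
        unfolding K_def using p q lX by (auto simp: assoc intro: mult_closed)
      have "q \<odot> l \<in> L" using L(3) p q by auto
      moreover have "q \<odot> p = (q \<odot> l) \<odot> r" using p q lX by (simp add: assoc)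
      ultimately show "q \<odot> p \<in> K"
        unfolding K_def using p by blast
    qed
    fix I assume I: "is_ideal I"
    obtain i l where i: "i \<in> I" and l: "l \<in> L" using I L(2) unfolding is_ideal_def by auto
    have iX: "i \<in> topspace X" using I i unfolding is_ideal_def by auto
    have lX: "l \<in> topspace X" using l LX by auto
    have il: "i \<odot> l \<in> I" "i \<odot> l \<in> L"
      using I i iX l lX L(3) unfolding is_ideal_def by auto
    have "L \<subseteq> I"
      using orbit[OF il(2)] I il(1) unfolding is_ideal_def by auto
    then show "K \<subseteq> I" using I unfolding K_def is_ideal_def by auto
  qed
qed

text \<open>In general only a right ideal, since left translations need not be continuous.\<close>

lemma closure_ideal_right:
  assumes I: "is_ideal I" and p: "p \<in> X closure_of I" and q: "q \<in> topspace X"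
  shows "p \<odot> q \<in> X closure_of I"
proof -
  have "(\<lambda>p. p \<odot> q) ` (X closure_of I) \<subseteq> X closure_of ((\<lambda>p. p \<odot> q) ` I)"
    using continuous[OF q] by (simp add: continuous_map_image_closure_subset)
  also have "\<dots> \<subseteq> X closure_of I"
    using I q unfolding is_ideal_def by (intro closure_of_mono) auto
  finally show ?thesis using p by auto
qed

end

section \<open>The Cantor topology on a powerset\<close>

text \<open>Sets stand for their characteristic functions under pointwise convergence. The space is
  used twice: to prove \<open>beta\<close> compact and as the phase space of the shift.\<close>

definition powerset_topology :: "'a set topology" where
  "powerset_topology =
     topology_generated_by (range (\<lambda>a. {F. a \<in> F}) \<union> range (\<lambda>a. {F. a \<notin> F}))"

lemma topspace_powerset_topology [simp]: "topspace powerset_topology = UNIV"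
  unfolding powerset_topology_def topology_generated_by_topspace by auto

lemma openin_powerset_topology_member:
  "openin powerset_topology {F. a \<in> F}" "openin powerset_topology {F. a \<notin> F}"
  unfolding powerset_topology_def by (rule topology_generated_by_Basis; auto)+

lemma continuous_map_into_powerset_topology:
  assumes "\<And>a. openin Y {y \<in> topspace Y. a \<in> f y}" "\<And>a. openin Y {y \<in> topspace Y. a \<notin> f y}"
  shows "continuous_map Y powerset_topology f"
  unfolding powerset_topology_def
proof (rule continuous_on_generated_topo)
  have eq: "f -` {F. a \<in> F} \<inter> topspace Y = {y \<in> topspace Y. a \<in> f y}"
    "f -` {F. a \<notin> F} \<inter> topspace Y = {y \<in> topspace Y. a \<notin> f y}" for a by auto
  show "openin Y (f -` U \<inter> topspace Y)"
    if "U \<in> range (\<lambda>a. {F. a \<in> F}) \<union> range (\<lambda>a. {F. a \<notin> F})" for U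
    using that assms eq by (elim UnE imageE) (metis (no_types))+
  show "f ` topspace Y \<subseteq> \<Union> (range (\<lambda>a. {F. a \<in> F}) \<union> range (\<lambda>a. {F. a \<notin> F}))"
    by auto
qed

text \<open>Tychonoff's theorem for a product of two-point discrete spaces, carried over along
  \<open>Collect\<close>.\<close>

lemma compact_powerset_topology: "compact_space (powerset_topology :: 'a set topology)"
proof -
  define Y where "Y = product_topology (\<lambda>_. discrete_topology (UNIV :: bool set)) (UNIV :: 'a set)"
  have tY: "topspace Y = UNIV" unfolding Y_def by auto
  have "compact_space Y"
    unfolding Y_def by (simp add: compact_space_product_topology compact_space_discrete_topology)
  moreover have "continuous_map Y powerset_topology Collect"
  proof (rule continuous_map_into_powerset_topology)
    have proj: "openin Y {f \<in> topspace Y. f a \<in> B}" for a B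
      unfolding Y_def
      by (rule openin_continuous_map_preimage[OF continuous_map_product_projection]) auto
    show "openin Y {y \<in> topspace Y. a \<in> Collect y}" for a
      using proj[of a "{True}"] by simp
    show "openin Y {y \<in> topspace Y. a \<notin> Collect y}" for a
      using proj[of a "{False}"] by simp
  qed
  ultimately have "compactin powerset_topology (Collect ` topspace Y)"
    unfolding compact_space_def by (rule image_compactin)
  moreover have "Collect ` topspace Y = (UNIV :: 'a set set)"
    unfolding tY
  proof (intro subset_antisym subset_UNIV subsetI)
    fix F :: "'a set"
    have "F = Collect (\<lambda>a. a \<in> F)" by simp
    then show "F \<in> range Collect" by (rule range_eqI[where x = "\<lambda>a. a \<in> F"])
  qed
  ultimately show ?thesis by (simp add: compact_space_def)
qed

lemma Hausdorff_powerset_topology: "Hausdorff_space powerset_topology"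
  unfolding Hausdorff_space_def
proof (intro allI impI)
  fix F G :: "'a set" assume "F \<in> topspace powerset_topology \<and> G \<in> topspace powerset_topology \<and> F \<noteq> G"
  then obtain a where "a \<in> F \<and> a \<notin> G \<or> a \<in> G \<and> a \<notin> F" by auto
  then show "\<exists>U V. openin powerset_topology U \<and> openin powerset_topology V \<and> F \<in> U \<and> G \<in> V \<and> disjnt U V"
  proof
    assume a: "a \<in> F \<and> a \<notin> G"
    show ?thesis
      by (rule exI[of _ "{F. a \<in> F}"], rule exI[of _ "{F. a \<notin> F}"])
        (use a in \<open>auto simp: openin_powerset_topology_member disjnt_def\<close>)
  next
    assume a: "a \<in> G \<and> a \<notin> F"
    show ?thesis
      by (rule exI[of _ "{F. a \<notin> F}"], rule exI[of _ "{F. a \<in> F}"])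
        (use a in \<open>auto simp: openin_powerset_topology_member disjnt_def\<close>)
  qed
qed

section \<open>Ultrafilters\<close>

lemma ultrafilter_Int_iff:
  "ultrafilter p \<Longrightarrow> A \<inter> B \<in> p \<longleftrightarrow> A \<in> p \<and> B \<in> p"
  unfolding ultrafilter_def by (meson inf_le1 inf_le2)

lemma ultrafilter_Compl_iff: "ultrafilter p \<Longrightarrow> - A \<in> p \<longleftrightarrow> A \<notin> p"
  unfolding ultrafilter_def by (metis Compl_disjoint)

lemma ultrafilter_mono: "\<lbrakk>ultrafilter p; A \<in> p; A \<subseteq> B\<rbrakk> \<Longrightarrow> B \<in> p"
  unfolding ultrafilter_def by blast

lemma ultrafilter_UNIV: "ultrafilter p \<Longrightarrow> UNIV \<in> p"
  unfolding ultrafilter_def by blast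

lemma ultrafilter_empty: "ultrafilter p \<Longrightarrow> {} \<notin> p"
  unfolding ultrafilter_def by blast

lemma ultrafilter_principal: "ultrafilter (principal s)"
  unfolding ultrafilter_def principal_def by auto

text \<open>Convergence of \<open>f\<close> to \<open>y\<close> along \<open>p\<close> can be
  checked coordinatewise: the coordinates settle the subbasic sets, and \<open>p\<close> is closed
  under finite intersections and supersets.\<close>

lemma ultrafilter_eventually_openin_powerset:
  assumes p: "ultrafilter p" and W: "openin powerset_topology W" "y \<in> W"
    and coord: "\<And>a. {s. a \<in> f s \<longleftrightarrow> a \<in> y} \<in> p"
  shows "{s. f s \<in> W} \<in> p"
proof -
  have "generate_topology_on (range (\<lambda>a. {F. a \<in> F}) \<union> range (\<lambda>a. {F. a \<notin> F})) W"
    using W(1) unfolding powerset_topology_def by (rule openin_topology_generated_by)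
  then show ?thesis using W(2)
  proof induction
    case (Int U V)
    then have "{s. f s \<in> U} \<inter> {s. f s \<in> V} \<in> p" by (simp add: ultrafilter_Int_iff[OF p])
    then show ?case by (simp add: Int_def)
  next
    case (UN K)
    then obtain U where "U \<in> K" "{s. f s \<in> U} \<in> p" by auto
    then show ?case by (auto elim: ultrafilter_mono[OF p])
  next
    case (Basis U)
    then obtain a where "U = {F. a \<in> F} \<or> U = {F. a \<notin> F}" by auto
    with Basis(2) have "{s. a \<in> f s \<longleftrightarrow> a \<in> y} \<subseteq> {s. f s \<in> U}" by auto
    then show ?case using coord[of a] ultrafilter_mono[OF p] by blast
  qed simp
qed

section \<open>The Stone-Cech compactification\<close>

lemma topspace_beta: "topspace beta = {p. ultrafilter p}"
  unfolding beta_def topology_generated_by_topspace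
  unfolding basic_clopen_def using ultrafilter_UNIV by blast

lemma openin_basic_clopen: "openin beta (basic_clopen A)"
  unfolding beta_def by (rule topology_generated_by_Basis) auto

lemma closedin_basic_clopen: "closedin beta (basic_clopen A)"
proof -
  have "topspace beta - basic_clopen A = basic_clopen (- A)"
    unfolding topspace_beta basic_clopen_def by (auto simp: ultrafilter_Compl_iff)
  moreover have "basic_clopen A \<subseteq> topspace beta"
    unfolding topspace_beta basic_clopen_def by auto
  ultimately show ?thesis by (simp add: closedin_def openin_basic_clopen)
qed

lemma continuous_map_into_beta:
  fixes f :: "'b \<Rightarrow> 'a set set"
  assumes op: "\<And>A. openin Y {y \<in> topspace Y. A \<in> f y}"
    and uf: "\<And>y. y \<in> topspace Y \<Longrightarrow> ultrafilter (f y)"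
  shows "continuous_map Y beta f"
  unfolding beta_def
proof (rule continuous_on_generated_topo)
  fix U :: "'a set set set" assume "U \<in> range basic_clopen"
  then obtain A where "U = basic_clopen A" by auto
  then have "f -` U \<inter> topspace Y = {y \<in> topspace Y. A \<in> f y}"
    using uf by (auto simp: basic_clopen_def)
  then show "openin Y (f -` U \<inter> topspace Y)" using op by simp
next
  have "f y \<in> basic_clopen UNIV" if "y \<in> topspace Y" for y
    using uf[OF that] by (simp add: basic_clopen_def ultrafilter_UNIV)
  then show "f ` topspace Y \<subseteq> \<Union>(range basic_clopen)" by blast
qed

text \<open>The sets \<open>basic_clopen A\<close> are closed under binary intersections, so they
  form a base and not just a subbase.\<close>

lemma openin_beta_basis:
  assumes W: "openin beta W" "p \<in> W" and p: "ultrafilter p"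
  obtains A where "A \<in> p" "basic_clopen A \<subseteq> W"
proof -
  have "generate_topology_on (range basic_clopen) W"
    using W(1) unfolding beta_def by (rule openin_topology_generated_by)
  then have "\<exists>A\<in>p. basic_clopen A \<subseteq> W" using W(2)
  proof induction
    case (Int U V)
    then obtain A B where AB: "A \<in> p" "B \<in> p" "basic_clopen A \<subseteq> U" "basic_clopen B \<subseteq> V" by auto
    moreover have "basic_clopen (A \<inter> B) = basic_clopen A \<inter> basic_clopen B"
      unfolding basic_clopen_def by (auto simp: ultrafilter_Int_iff)
    ultimately show ?case using ultrafilter_Int_iff[OF p, of A B] by blast
  next
    case (UN K)
    then show ?case by (meson UnionE Union_upper subset_trans)
  next
    case (Basis U)
    then show ?case unfolding basic_clopen_def by auto
  qed simp
  with that show thesis by auto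
qed

text \<open>If \<open>C\<close> and \<open>A\<close> are in \<open>p\<close>, they share a point,
  whose principal ultrafilter lies in \<open>basic_clopen A\<close>. This turns the closures in
  \<open>delta\<close> into membership conditions.\<close>

lemma beta_closure_of_principal: "beta closure_of (principal ` C) = basic_clopen C"
proof (intro subset_antisym closure_of_minimal)
  show "principal ` C \<subseteq> basic_clopen C"
    using ultrafilter_principal by (auto simp: basic_clopen_def principal_def)
  show "closedin beta (basic_clopen C)" by (rule closedin_basic_clopen)
  show "basic_clopen C \<subseteq> beta closure_of (principal ` C)"
  proof
    fix p assume "p \<in> basic_clopen C"
    then have p: "ultrafilter p" "C \<in> p" unfolding basic_clopen_def by auto
    show "p \<in> beta closure_of (principal ` C)"
      unfolding in_closure_of
    proof (intro conjI allI impI)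
      show "p \<in> topspace beta" using p by (simp add: topspace_beta)
      fix W assume "p \<in> W \<and> openin beta W"
      then obtain A where A: "A \<in> p" "basic_clopen A \<subseteq> W"
        using openin_beta_basis p by metis
      then have "C \<inter> A \<noteq> {}" using p ultrafilter_Int_iff ultrafilter_empty by metis
      then obtain s where "s \<in> C" "s \<in> A" by auto
      moreover from this have "principal s \<in> W"
        using A(2) ultrafilter_principal[of s] by (auto simp: basic_clopen_def principal_def)
      ultimately show "\<exists>q. q \<in> principal ` C \<and> q \<in> W" by auto
    qed
  qed
qed

lemma Hausdorff_beta: "Hausdorff_space beta"
  unfolding Hausdorff_space_def
proof (intro allI impI)
  fix p q :: "'a set set" assume "p \<in> topspace beta \<and> q \<in> topspace beta \<and> p \<noteq> q"
  then have p: "ultrafilter p" and q: "ultrafilter q" and "p \<noteq> q" by (auto simp: topspace_beta)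
  \<comment> \<open>Ultrafilters are maximal, so distinct ones are incomparable.\<close>
  have "q \<subseteq> p" if "p \<subseteq> q"
    using that p q by (metis ultrafilter_Compl_iff subset_iff)
  with \<open>p \<noteq> q\<close> obtain A where A: "A \<in> p" "A \<notin> q" by blast
  show "\<exists>U V. openin beta U \<and> openin beta V \<and> p \<in> U \<and> q \<in> V \<and> disjnt U V"
    by (rule exI[of _ "basic_clopen A"], rule exI[of _ "basic_clopen (- A)"])
      (use p q A in
        \<open>simp add: openin_basic_clopen, auto simp: disjnt_def basic_clopen_def ultrafilter_Compl_iff\<close>)
qed

text \<open>Each instance of an ultrafilter axiom restricts only finitely many coordinates, so it
  cuts out a closed set.\<close>

lemma closedin_ultrafilters: "closedin powerset_topology {p. ultrafilter p}"
proof -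
  have cl1: "closedin powerset_topology {F. a \<in> F}" for a :: "'a set"
    using openin_powerset_topology_member(2)[of a] by (simp add: closedin_def Compl_eq_Diff_UNIV[symmetric] Collect_neg_eq)
  have cl2: "closedin powerset_topology {F. a \<notin> F}" for a :: "'a set"
    using openin_powerset_topology_member(1)[of a] by (simp add: closedin_def Compl_eq_Diff_UNIV[symmetric] Collect_neg_eq)
  define I where "I A B = ({F. A \<notin> F} \<union> {F. B \<notin> F}) \<union> {F. A \<inter> B \<in> F}" for A B :: "'a set"
  \<comment> \<open>Writing a superset of \<open>A\<close> as \<open>A \<union> B\<close> lets the
    pair range over all sets without a side condition.\<close>
  define J where "J A B = {F. A \<notin> F} \<union> {F. A \<union> B \<in> F}" for A B :: "'a set"
  define N where "N A = {F. A \<in> F} \<union> {F. - A \<in> F}" for A :: "'a set"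
  have "{p. ultrafilter p} = {F. {} \<notin> F} \<inter> {F. UNIV \<in> F}
      \<inter> (\<Inter>z\<in>UNIV. I (fst z) (snd z)) \<inter> (\<Inter>z\<in>UNIV. J (fst z) (snd z)) \<inter> (\<Inter>A\<in>UNIV. N A)"
    (is "?L = ?R")
  proof
    show "?L \<subseteq> ?R"
    proof
      fix p assume "p \<in> ?L"
      then have p: "ultrafilter p" by simp
      have "p \<in> I A B" "p \<in> J A B" "p \<in> N A" for A B
        using ultrafilter_Int_iff[OF p, of A B] ultrafilter_mono[OF p, of A "A \<union> B"]
          ultrafilter_Compl_iff[OF p, of A] unfolding I_def J_def N_def by auto
      then show "p \<in> ?R"
        using ultrafilter_UNIV[OF p] ultrafilter_empty[OF p] by auto
    qed
    show "?R \<subseteq> ?L"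
    proof
      fix F assume F: "F \<in> ?R"
      have "B \<in> F" if "A \<in> F" "A \<subseteq> B" for A B
      proof -
        have "F \<in> J A B" using F by auto
        moreover have "A \<union> B = B" using that by auto
        ultimately show ?thesis using that unfolding J_def by auto
      qed
      moreover have "A \<inter> B \<in> F" if "A \<in> F" "B \<in> F" for A B
      proof -
        have "F \<in> I A B" using F by auto
        then show ?thesis using that unfolding I_def by auto
      qed
      ultimately show "F \<in> ?L" using F unfolding ultrafilter_def N_def by auto
    qed
  qed
  moreover have "closedin powerset_topology ?R"
    unfolding I_def J_def N_def by (intro closedin_Int closedin_INT closedin_Un cl1 cl2) auto
  ultimately show ?thesis by simp
qed

text \<open>The identity maps the ultrafilters, a closed subspace of a compact space, continuously
  onto \<open>beta\<close>.\<close>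

lemma compact_beta: "compact_space (beta :: 'a set set topology)"
proof -
  let ?Y = "subtopology powerset_topology {p :: 'a set set. ultrafilter p}"
  have "continuous_map ?Y beta id"
  proof (rule continuous_map_into_beta)
    fix A :: "'a set"
    have "{p \<in> topspace ?Y. A \<in> id p} = {F. A \<in> F} \<inter> {p. ultrafilter p}" by auto
    then show "openin ?Y {p \<in> topspace ?Y. A \<in> id p}"
      by (simp only: openin_subtopology_Int openin_powerset_topology_member)
  qed simp
  moreover have "compact_space ?Y"
    using compact_powerset_topology closedin_ultrafilters
    by (intro compact_space_subtopology closedin_compact_space)
  ultimately have "compactin beta (id ` topspace ?Y)"
    unfolding compact_space_def by (rule image_compactin[rotated])
  then show ?thesis by (simp add: compact_space_def topspace_beta)
qed

section \<open>The semigroup of ultrafilters containing all domains\<close>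

lemma mem_delta_iff: "p \<in> delta m \<longleftrightarrow> ultrafilter p \<and> (\<forall>x. phi m x \<in> p)"
  unfolding delta_def beta_closure_of_principal by (auto simp: basic_clopen_def)

lemma closedin_delta: "closedin beta (delta m)"
  unfolding delta_def by (intro closedin_INT) auto

lemma topspace_delta: "topspace (subtopology beta (delta m)) = delta m"
  using closedin_delta[of m] closedin_subset by fastforce

text \<open>Adequacy makes the clopen sets of the \<open>sigma m H\<close> nonempty, and unions of
  the \<open>H\<close> make them directed. A common point contains each \<open>phi m x\<close>, by
  \<open>H = {x}\<close>.\<close>

lemma delta_nonempty:
  assumes "adequate m"
  shows "delta m \<noteq> {}"
proof -
  define \<C> where "\<C> = (\<lambda>H. basic_clopen (sigma m H)) ` {H. finite H \<and> H \<noteq> {}}"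
  have "\<Inter>\<C> \<noteq> {}"
  proof (rule compact_space_Inter_directed_nonempty[OF compact_beta])
    show "\<C> \<noteq> {}" unfolding \<C>_def by auto
    show "closedin beta C \<and> C \<noteq> {}" if C: "C \<in> \<C>" for C
    proof -
      obtain H where H: "finite H" "H \<noteq> {}" "C = basic_clopen (sigma m H)"
        using C unfolding \<C>_def by auto
      then obtain s where "s \<in> sigma m H" using assms unfolding adequate_def by blast
      then have "principal s \<in> C"
        using H(3) ultrafilter_principal[of s] by (simp add: basic_clopen_def principal_def)
      then show ?thesis using H(3) closedin_basic_clopen by auto
    qed
    show "\<exists>E\<in>\<C>. E \<subseteq> C \<inter> D" if CD: "C \<in> \<C>" "D \<in> \<C>" for C D
    proof -
      obtain H G where HG: "finite H" "H \<noteq> {}" "C = basic_clopen (sigma m H)"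
        "finite G" "G \<noteq> {}" "D = basic_clopen (sigma m G)"
        using CD unfolding \<C>_def by auto
      have "basic_clopen (sigma m (H \<union> G)) \<subseteq> C \<inter> D"
        using HG unfolding basic_clopen_def sigma_def
        by (auto elim: ultrafilter_mono)
      then show ?thesis using HG unfolding \<C>_def by blast
    qed
  qed
  then obtain p where p: "p \<in> \<Inter>\<C>" by auto
  have "ultrafilter p \<and> phi m x \<in> p" for x
  proof -
    have "basic_clopen (sigma m {x}) \<in> \<C>" unfolding \<C>_def by auto
    then show ?thesis using p unfolding basic_clopen_def sigma_def by auto
  qed
  then have "p \<in> delta m" by (simp add: mem_delta_iff)
  then show ?thesis by auto
qed

section \<open>Inverse translates and products of ultrafilters\<close>

lemma preimage_op_Int: "preimage_op m x (A \<inter> B) = preimage_op m x A \<inter> preimage_op m x B"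
  unfolding preimage_op_def by auto

lemma preimage_op_Compl: "preimage_op m x (- A) = phi m x \<inter> - preimage_op m x A"
  unfolding preimage_op_def by auto

lemma preimage_op_mono: "A \<subseteq> B \<Longrightarrow> preimage_op m x A \<subseteq> preimage_op m x B"
  unfolding preimage_op_def by auto

lemma preimage_op_UNIV: "preimage_op m x UNIV = phi m x"
  unfolding preimage_op_def by auto

lemma preimage_op_product:
  assumes "partial_semigroup m" "m a b = Some c"
  shows "preimage_op m c A = preimage_op m b (preimage_op m a A)"
proof (rule set_eqI)
  fix t
  have "Option.bind (m a b) (\<lambda>u. m u t) = Option.bind (m b t) (\<lambda>v. m a v)"
    using assms unfolding partial_semigroup_def by blast
  then have "m c t = Option.bind (m b t) (\<lambda>v. m a v)" using assms by simp
  then show "t \<in> preimage_op m c A \<longleftrightarrow> t \<in> preimage_op m b (preimage_op m a A)"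
    unfolding preimage_op_def phi_def by (cases "m b t") auto
qed

text \<open>Associativity transfers undefinedness: if \<open>a b\<close> is undefined, then so is
  \<open>a (b t)\<close> for every \<open>t\<close>.\<close>

lemma preimage_op_undefined:
  assumes "partial_semigroup m" "m a b = None"
  shows "preimage_op m b (preimage_op m a A) = {}"
proof -
  have "Option.bind (m b t) (\<lambda>v. m a v) = None" for t
    using assms unfolding partial_semigroup_def by (metis Option.bind.bind_lzero)
  then have "m b t = Some v \<Longrightarrow> m a v = None" for t v
    by (metis Option.bind.bind_lunit)
  then show ?thesis
    unfolding preimage_op_def phi_def by auto
qed

text \<open>Where \<open>a b\<close> is defined, both sides ask for the inverse translate of
  \<open>A\<close> by \<open>a b\<close> to be in \<open>q\<close>; elsewhere both fail, since the
  empty set is not in \<open>q\<close>. This carries the associativity of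
  \<open>uf_mult\<close>.\<close>

lemma preimage_op_Collect:
  assumes m: "partial_semigroup m" and q: "ultrafilter q"
  shows "preimage_op m a {x. preimage_op m x A \<in> q} = {b. preimage_op m b (preimage_op m a A) \<in> q}"
proof (rule set_eqI)
  fix b
  show "b \<in> preimage_op m a {x. preimage_op m x A \<in> q} \<longleftrightarrow>
      b \<in> {b. preimage_op m b (preimage_op m a A) \<in> q}"
  proof (cases "m a b")
    case None
    then show ?thesis
      using ultrafilter_empty[OF q]
      by (simp add: preimage_op_undefined[OF m None]) (simp add: preimage_op_def phi_def)
  next
    case (Some c)
    then show ?thesis
      by (simp add: preimage_op_product[OF m Some, symmetric])
        (simp add: preimage_op_def[of m a] phi_def)
  qed
qed

text \<open>Membership of \<open>q\<close> in \<open>delta m\<close> enters for complements and for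
  \<open>UNIV\<close>: inverse translates live inside \<open>phi m x\<close>, which must itself be
  in \<open>q\<close>.\<close>

lemma ultrafilter_uf_mult:
  assumes p: "ultrafilter p" and q: "q \<in> delta m"
  shows "ultrafilter (uf_mult m p q)"
proof -
  have q': "ultrafilter q" "\<And>x. phi m x \<in> q" using q by (auto simp: mem_delta_iff)
  have Int: "{x. preimage_op m x (A \<inter> B) \<in> q}
      = {x. preimage_op m x A \<in> q} \<inter> {x. preimage_op m x B \<in> q}" for A B
    by (auto simp: preimage_op_Int ultrafilter_Int_iff[OF q'(1)])
  have Compl: "{x. preimage_op m x (- A) \<in> q} = - {x. preimage_op m x A \<in> q}" for A
    by (auto simp: preimage_op_Compl ultrafilter_Int_iff[OF q'(1)] ultrafilter_Compl_iff[OF q'(1)] q'(2))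
  have mono: "{x. preimage_op m x A \<in> q} \<subseteq> {x. preimage_op m x B \<in> q}" if "A \<subseteq> B" for A B
    using preimage_op_mono[OF that] ultrafilter_mono[OF q'(1)] by blast
  have univ: "{x. preimage_op m x UNIV \<in> q} = UNIV"
    by (simp add: preimage_op_UNIV q'(2))
  have empt: "{x. preimage_op m x {} \<in> q} = {}"
    using ultrafilter_empty[OF q'(1)] by (simp add: preimage_op_def)
  have mem: "A \<in> uf_mult m p q \<longleftrightarrow> {x. preimage_op m x A \<in> q} \<in> p" for A
    by (simp add: uf_mult_def)
  show ?thesis
    unfolding ultrafilter_def[of "uf_mult m p q"] mem Int Compl univ empt
    using ultrafilter_mono[OF p _ mono] ultrafilter_empty[OF p] ultrafilter_UNIV[OF p]
      ultrafilter_Int_iff[OF p] ultrafilter_Compl_iff[OF p] by blast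
qed

text \<open>For \<open>x\<close> in \<open>phi m y\<close>, the inverse translate of
  \<open>phi m y\<close> by \<open>x\<close> is \<open>phi m z\<close> with \<open>z = y x\<close>,
  and so it is in \<open>q\<close>.\<close>

lemma uf_mult_in_delta:
  assumes m: "partial_semigroup m" and p: "p \<in> delta m" and q: "q \<in> delta m"
  shows "uf_mult m p q \<in> delta m"
proof -
  have "phi m y \<in> uf_mult m p q" for y
  proof -
    have "preimage_op m x (phi m y) \<in> q" if x: "x \<in> phi m y" for x
    proof -
      obtain z where z: "m y x = Some z" using x unfolding phi_def by auto
      have "preimage_op m x (phi m y) = phi m z"
        using preimage_op_product[OF m z, of UNIV] by (simp add: preimage_op_UNIV)
      then show ?thesis using q by (simp add: mem_delta_iff)
    qed
    then have "phi m y \<subseteq> {x. preimage_op m x (phi m y) \<in> q}" by auto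
    then show ?thesis
      using p unfolding uf_mult_def mem_delta_iff by (auto elim: ultrafilter_mono)
  qed
  then show ?thesis
    using p q by (simp add: mem_delta_iff ultrafilter_uf_mult)
qed

lemma uf_mult_assoc:
  assumes m: "partial_semigroup m" and r: "ultrafilter r"
  shows "uf_mult m (uf_mult m p q) r = uf_mult m p (uf_mult m q r)"
  unfolding uf_mult_def by (simp add: preimage_op_Collect[OF m r])

lemma continuous_uf_mult:
  assumes m: "partial_semigroup m" and q: "q \<in> delta m"
  shows "continuous_map (subtopology beta (delta m)) (subtopology beta (delta m)) (\<lambda>p. uf_mult m p q)"
  unfolding continuous_map_in_subtopology
proof
  show "(\<lambda>p. uf_mult m p q) \<in> topspace (subtopology beta (delta m)) \<rightarrow> delta m"
    using uf_mult_in_delta[OF m _ q] by (auto simp: topspace_delta)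
  show "continuous_map (subtopology beta (delta m)) beta (\<lambda>p. uf_mult m p q)"
  proof (rule continuous_map_into_beta)
    fix A
    have "{p \<in> delta m. A \<in> uf_mult m p q} = basic_clopen {x. preimage_op m x A \<in> q} \<inter> delta m"
      by (auto simp: uf_mult_def basic_clopen_def mem_delta_iff)
    then show "openin (subtopology beta (delta m))
        {p \<in> topspace (subtopology beta (delta m)). A \<in> uf_mult m p q}"
      unfolding topspace_delta by (simp add: openin_subtopology_Int openin_basic_clopen)
  qed (use ultrafilter_uf_mult[OF _ q] in \<open>simp add: mem_delta_iff\<close>)
qed

lemma compact_right_topological_semigroup_delta:
  assumes m: "partial_semigroup m" and "adequate m"
  shows "compact_right_topological_semigroup (subtopology beta (delta m)) (uf_mult m)"
proof
  show "compact_space (subtopology beta (delta m))"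
    using compact_beta closedin_delta by (intro compact_space_subtopology closedin_compact_space)
  show "Hausdorff_space (subtopology beta (delta m))"
    by (rule Hausdorff_space_subtopology[OF Hausdorff_beta])
  show "topspace (subtopology beta (delta m)) \<noteq> {}"
    unfolding topspace_delta using assms(2) by (rule delta_nonempty)
qed (use assms in \<open>simp_all add: topspace_delta del: topspace_subtopology add: delta_nonempty continuous_uf_mult uf_mult_assoc mem_delta_iff\<close>)

text \<open>The \<open>LEAST\<close> in \<open>smallest_ideal\<close> is informative only once a
  least ideal exists, which the abstract theory provides.\<close>

lemma two_sided_ideal_smallest_ideal:
  assumes m: "partial_semigroup m" and "adequate m"
  shows "two_sided_ideal m (smallest_ideal m)"
proof -
  interpret compact_right_topological_semigroup "subtopology beta (delta m)" "uf_mult m"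
    by (rule compact_right_topological_semigroup_delta[OF assms])
  have eq: "is_ideal I \<longleftrightarrow> two_sided_ideal m I" for I
    unfolding is_ideal_def two_sided_ideal_def topspace_delta ..
  obtain K where K: "two_sided_ideal m K" "\<And>I. two_sided_ideal m I \<Longrightarrow> K \<subseteq> I"
    using exists_least_ideal unfolding eq by metis
  then have "smallest_ideal m = K"
    unfolding smallest_ideal_def by (rule Least_equality)
  with K show ?thesis by simp
qed

section \<open>Quasi-central sets and dynamical systems\<close>

text \<open>Recurrence of \<open>y\<close> along with \<open>x\<close> is what closes the set of
  limiting ultrafilters under products: the limit of \<open>T s x\<close> along \<open>q\<close> is
  \<open>y\<close>, and the limit of \<open>T s y\<close> along \<open>p\<close> is \<open>y\<close>
  again.\<close>

lemma quasi_central_if_recurrent: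
  fixes X :: "'x topology"
  assumes m: "partial_semigroup m" and ad: "adequate m"
    and sys: "dynamical_system m X T" and x: "x \<in> topspace X" and y: "y \<in> topspace X"
    and U: "neighbourhood X y U"
    and rec: "jointly_intermittently_uniformly_recurrent m X T x y"
  shows "quasi_central m {s. T s x \<in> U}"
proof -
  let ?Y = "subtopology beta (delta m)"
  interpret compact_right_topological_semigroup ?Y "uf_mult m"
    by (rule compact_right_topological_semigroup_delta[OF m ad])
  define K where "K = ?Y closure_of smallest_ideal m"
  have ideal: "is_ideal (smallest_ideal m)"
    using two_sided_ideal_smallest_ideal[OF m ad]
    unfolding is_ideal_def two_sided_ideal_def topspace_delta .
  then have ideal_sub: "smallest_ideal m \<subseteq> K"
    unfolding K_def is_ideal_def by (simp add: closure_of_subset)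
  have K_sub: "K \<subseteq> delta m"
    unfolding K_def using closure_of_subset_topspace[of ?Y] topspace_delta by blast
  define R where "R V = {s. T s x \<in> V \<and> T s y \<in> V}" for V
  define \<V> where "\<V> = {V. openin X V \<and> y \<in> V}"
  have R_Int: "R (V \<inter> W) = R V \<inter> R W" for V W unfolding R_def by auto
  \<comment> \<open>The ultrafilters in \<open>K\<close> along which both \<open>T s x\<close> and
    \<open>T s y\<close> converge to \<open>y\<close>.\<close>
  define E where "E = \<Inter>((\<lambda>V. K \<inter> basic_clopen (R V)) ` \<V>)"
  have top: "topspace X \<in> \<V>" using y unfolding \<V>_def by auto
  have E_iff: "p \<in> E \<longleftrightarrow> p \<in> K \<and> (\<forall>V\<in>\<V>. R V \<in> p)" for p
    using top K_sub unfolding E_def basic_clopen_def by (auto simp: mem_delta_iff)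
  have cl: "closedin ?Y (K \<inter> basic_clopen (R V))" for V
  proof -
    have "closedin ?Y (basic_clopen (R V) \<inter> delta m)"
      using closedin_basic_clopen by (metis closedin_subtopology)
    moreover have "closedin ?Y K" unfolding K_def by (rule closedin_closure_of)
    ultimately have "closedin ?Y (K \<inter> (basic_clopen (R V) \<inter> delta m))"
      by (rule closedin_Int[rotated])
    moreover have "K \<inter> (basic_clopen (R V) \<inter> delta m) = K \<inter> basic_clopen (R V)"
      using K_sub by auto
    ultimately show ?thesis by simp
  qed
  have "E \<noteq> {}"
    unfolding E_def
  proof (rule compact_space_Inter_directed_nonempty[OF compact])
    show "(\<lambda>V. K \<inter> basic_clopen (R V)) ` \<V> \<noteq> {}" using top by auto
    show "closedin ?Y C \<and> C \<noteq> {}" if C: "C \<in> (\<lambda>V. K \<inter> basic_clopen (R V)) ` \<V>" for C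
    proof -
      obtain V where V: "V \<in> \<V>" "C = K \<inter> basic_clopen (R V)" using C by auto
      have "neighbourhood X y V"
        using V(1) openin_subset unfolding neighbourhood_def \<V>_def by auto
      then have "piecewise_syndetic m (R V)"
        using rec unfolding jointly_intermittently_uniformly_recurrent_def R_def by auto
      then have "C \<noteq> {}" using ideal_sub V(2) unfolding piecewise_syndetic_def by auto
      with cl V(2) show ?thesis by auto
    qed
    show "\<exists>F\<in>(\<lambda>V. K \<inter> basic_clopen (R V)) ` \<V>. F \<subseteq> C \<inter> D"
      if CD: "C \<in> (\<lambda>V. K \<inter> basic_clopen (R V)) ` \<V>" "D \<in> (\<lambda>V. K \<inter> basic_clopen (R V)) ` \<V>" for C D
    proof -
      obtain V W where VW: "V \<in> \<V>" "C = K \<inter> basic_clopen (R V)" "W \<in> \<V>" "D = K \<inter> basic_clopen (R W)"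
        using CD by auto
      have "V \<inter> W \<in> \<V>" using VW unfolding \<V>_def by auto
      moreover have "K \<inter> basic_clopen (R (V \<inter> W)) \<subseteq> C \<inter> D"
        using VW unfolding R_Int basic_clopen_def by (auto simp: ultrafilter_Int_iff)
      ultimately show ?thesis by blast
    qed
  qed
  moreover have "closedin ?Y E"
    unfolding E_def using cl top by (intro closedin_INT) auto
  moreover have "uf_mult m p q \<in> E" if p: "p \<in> E" and q: "q \<in> E" for p q
    unfolding E_iff
  proof (intro conjI ballI)
    have pK: "p \<in> K" and qK: "q \<in> K" using p q E_iff by auto
    then have pd: "p \<in> delta m" and qd: "q \<in> delta m" using K_sub by auto
    then have pu: "ultrafilter p" and qu: "ultrafilter q" by (auto simp: mem_delta_iff)
    show "uf_mult m p q \<in> K"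
      using closure_ideal_right[OF ideal] pK qd unfolding K_def topspace_delta by blast
    fix V assume V: "V \<in> \<V>"
    have "preimage_op m s (R V) \<in> q" if s: "s \<in> R V" for s
    proof -
      \<comment> \<open>Since \<open>T s y\<close> is in \<open>V\<close>, continuity makes this an
        open neighbourhood of \<open>y\<close>, so \<open>q\<close> contains its joint return
        times.\<close>
      let ?W = "{z \<in> topspace X. T s z \<in> V}"
      have "openin X ?W"
        using sys V unfolding dynamical_system_def \<V>_def
        by (auto intro: openin_continuous_map_preimage)
      then have "?W \<in> \<V>" using s y unfolding \<V>_def R_def by auto
      then have "R ?W \<in> q" using q E_iff by auto
      \<comment> \<open>The composition law holds only for defined products; the restriction to
        \<open>phi m s\<close> is harmless because \<open>q\<close> is in
        \<open>delta m\<close>.\<close>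
      then have "R ?W \<inter> phi m s \<in> q"
        using qd by (simp add: ultrafilter_Int_iff[OF qu] mem_delta_iff)
      moreover have "R ?W \<inter> phi m s \<subseteq> preimage_op m s (R V)"
      proof
        fix t assume t: "t \<in> R ?W \<inter> phi m s"
        then have "T s (T t z) = T (the (m s t)) z" if "z \<in> topspace X" for z
          using sys that unfolding dynamical_system_def by auto
        with t x y show "t \<in> preimage_op m s (R V)"
          unfolding preimage_op_def R_def by auto
      qed
      ultimately show ?thesis by (rule ultrafilter_mono[OF qu])
    qed
    then have "R V \<subseteq> {s. preimage_op m s (R V) \<in> q}" by auto
    moreover have "R V \<in> p" using p V E_iff by auto
    ultimately show "R V \<in> uf_mult m p q"
      unfolding uf_mult_def using ultrafilter_mono[OF pu] by auto
  qed
  ultimately obtain e where e: "e \<in> E" "uf_mult m e e = e"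
    using exists_idempotent[of E] by metis
  have eK: "e \<in> K" using e E_iff by auto
  obtain V where V: "openin X V" "y \<in> V" "V \<subseteq> U" using U unfolding neighbourhood_def by auto
  then have "R V \<in> e" using e E_iff unfolding \<V>_def by auto
  moreover have "R V \<subseteq> {s. T s x \<in> U}" using V unfolding R_def by auto
  moreover have "ultrafilter e" using eK K_sub by (auto simp: mem_delta_iff)
  ultimately have "{s. T s x \<in> U} \<in> e" using ultrafilter_mono by blast
  with e eK show ?thesis unfolding quasi_central_def K_def by auto
qed

text \<open>A family of sets stands for a 0-1 sequence indexed by \<open>S\<close> with an identity adjoined: the
  coordinate of the identity is the empty set, that of \<open>u\<close> is \<open>{u}\<close>, and the remaining coordinates
  are set to 0. The system is right translation \<open>u \<mapsto> u s\<close> of the coordinates.\<close>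

definition translate_coord :: "'s partial_op \<Rightarrow> 's \<Rightarrow> 's set \<Rightarrow> 's set option" where
  "translate_coord m s B =
     (if B = {} then Some {s}
      else if is_singleton B then map_option (\<lambda>v. {v}) (m (the_elem B) s)
      else None)"

definition shift :: "'s partial_op \<Rightarrow> 's \<Rightarrow> 's set set \<Rightarrow> 's set set" where
  "shift m s F = {B. case translate_coord m s B of None \<Rightarrow> False | Some C \<Rightarrow> C \<in> F}"

lemma in_shift:
  "{} \<in> shift m s F \<longleftrightarrow> {s} \<in> F"
  "{u} \<in> shift m s F \<longleftrightarrow> (\<exists>v. m u s = Some v \<and> {v} \<in> F)"
  "\<lbrakk>B \<noteq> {}; \<not> is_singleton B\<rbrakk> \<Longrightarrow> B \<notin> shift m s F"
  unfolding shift_def translate_coord_def by (auto split: option.splits)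

text \<open>Coordinate \<open>u\<close> of the left side is coordinate \<open>(u s) t\<close> of
  \<open>F\<close>, and associativity identifies this with \<open>u w\<close>, definedness
  included.\<close>

lemma shift_shift:
  assumes m: "partial_semigroup m" and st: "m s t = Some w"
  shows "shift m s (shift m t F) = shift m w F"
proof (rule set_eqI)
  fix B :: "'a set"
  consider "B = {}" | u where "B = {u}" | "B \<noteq> {}" "\<not> is_singleton B"
    by (auto elim: is_singletonE)
  then show "B \<in> shift m s (shift m t F) \<longleftrightarrow> B \<in> shift m w F"
  proof cases
    case 1
    then show ?thesis using st by (simp add: in_shift)
  next
    case 2
    have "Option.bind (m u s) (\<lambda>v. m v t) = m u w"
      using m st unfolding partial_semigroup_def by (metis Option.bind.bind_lunit)
    then show ?thesis using 2 by (cases "m u s") (auto simp: in_shift)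
  next
    case 3
    then show ?thesis by (simp add: in_shift)
  qed
qed

text \<open>Each coordinate of the image is either a single coordinate of \<open>F\<close> or
  constantly 0.\<close>

lemma continuous_shift: "continuous_map powerset_topology powerset_topology (shift m s)"
proof (rule continuous_map_into_powerset_topology)
  fix B :: "'a set"
  show "openin powerset_topology {F \<in> topspace powerset_topology. B \<in> shift m s F}"
    by (cases "translate_coord m s B") (simp_all add: shift_def openin_powerset_topology_member)
  show "openin powerset_topology {F \<in> topspace powerset_topology. B \<notin> shift m s F}"
    using openin_topspace[of powerset_topology]
    by (cases "translate_coord m s B") (simp_all add: shift_def openin_powerset_topology_member)
qed

lemma dynamical_system_shift:
  assumes "partial_semigroup m"
  shows "dynamical_system m powerset_topology (shift m)"
  unfolding dynamical_system_def
  using compact_powerset_topology Hausdorff_powerset_topology continuous_shift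
    shift_shift[OF assms] by (fastforce simp: phi_def)

lemma recurrent_if_quasi_central:
  assumes m: "partial_semigroup m" and A: "quasi_central m A"
  obtains x y U where "neighbourhood powerset_topology y U"
    "jointly_intermittently_uniformly_recurrent m powerset_topology (shift m) x y"
    "A = {s. shift m s x \<in> U}"
proof -
  let ?Y = "subtopology beta (delta m)"
  obtain p where pK: "p \<in> ?Y closure_of smallest_ideal m" and pp: "uf_mult m p p = p" and Ap: "A \<in> p"
    using A unfolding quasi_central_def by auto
  have pd: "p \<in> delta m"
    using pK closure_of_subset_topspace[of ?Y] topspace_delta by blast
  then have p: "ultrafilter p" by (simp add: mem_delta_iff)
  \<comment> \<open>The characteristic function of \<open>A\<close>, with value 0 at the adjoined
    identity.\<close>
  define x where "x = (\<lambda>s. {s}) ` A"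
  \<comment> \<open>The limit of \<open>shift m s x\<close> along \<open>p\<close>, taken coordinate
    by coordinate.\<close>
  define y where "y = {B. {s. B \<in> shift m s x} \<in> p}"
  have x_iff: "{s} \<in> x \<longleftrightarrow> s \<in> A" for s unfolding x_def by auto
  have y_empty: "{} \<in> y" using Ap unfolding y_def by (simp add: in_shift x_iff)
  have "{s. {u} \<in> shift m s x} = preimage_op m u A" for u
    by (auto simp: in_shift x_iff preimage_op_def phi_def)
  then have y_sing: "{u} \<in> y \<longleftrightarrow> preimage_op m u A \<in> p" for u unfolding y_def by simp
  \<comment> \<open>Along \<open>p\<close>, \<open>shift m s y\<close> converges to
    \<open>y\<close>: idempotency is applied to \<open>A\<close> at the identity coordinate and to
    \<open>preimage_op m u A\<close> at coordinate \<open>u\<close>.\<close>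
  have y_fix: "{s. B \<in> shift m s y} \<in> p \<longleftrightarrow> B \<in> y" for B
  proof -
    have pp_iff: "C \<in> p \<longleftrightarrow> {s. preimage_op m s C \<in> p} \<in> p" for C
      using pp unfolding uf_mult_def by blast
    consider "B = {}" | u where "B = {u}" | "B \<noteq> {}" "\<not> is_singleton B"
      by (metis is_singletonE)
    then show ?thesis
    proof cases
      case 1
      then show ?thesis using Ap pp_iff[of A] y_empty by (simp add: in_shift y_sing)
    next
      case 2
      have "{s. {u} \<in> shift m s y} = preimage_op m u {v. preimage_op m v A \<in> p}"
        by (auto simp: in_shift y_sing preimage_op_def phi_def)
      also have "\<dots> = {s. preimage_op m s (preimage_op m u A) \<in> p}"
        by (rule preimage_op_Collect[OF m p])
      finally show ?thesis using 2 pp_iff[of "preimage_op m u A"] by (simp add: y_sing)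
    next
      case 3
      then show ?thesis using ultrafilter_empty[OF p] by (simp add: in_shift y_def)
    qed
  qed
  \<comment> \<open>Converts a limiting truth value into agreement on a set in \<open>p\<close>, as
    coordinatewise convergence requires.\<close>
  have decide: "{s. P s \<longleftrightarrow> b} \<in> p" if "{s. P s} \<in> p \<longleftrightarrow> b" for P b
    using that ultrafilter_Compl_iff[OF p, of "{s. P s}"] by (cases b) (auto simp: Collect_neg_eq)
  have lim: "{s. shift m s x \<in> W \<and> shift m s y \<in> W} \<in> p"
    if W: "openin powerset_topology W" "y \<in> W" for W
  proof -
    have "{s. shift m s x \<in> W} \<in> p"
      by (rule ultrafilter_eventually_openin_powerset[OF p W]) (rule decide, simp add: y_def)
    moreover have "{s. shift m s y \<in> W} \<in> p"
      by (rule ultrafilter_eventually_openin_powerset[OF p W]) (rule decide, rule y_fix)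
    ultimately have "{s. shift m s x \<in> W} \<inter> {s. shift m s y \<in> W} \<in> p"
      by (simp add: ultrafilter_Int_iff[OF p])
    then show ?thesis by (simp add: Int_def)
  qed
  show thesis
  proof (rule that[of y "{F. {} \<in> F}" x])
    show "neighbourhood powerset_topology y {F. {} \<in> F}"
      unfolding neighbourhood_def using openin_powerset_topology_member(1)[of "{}"] y_empty by auto
    show "A = {s. shift m s x \<in> {F. {} \<in> F}}" by (simp add: in_shift x_iff)
    show "jointly_intermittently_uniformly_recurrent m powerset_topology (shift m) x y"
      unfolding jointly_intermittently_uniformly_recurrent_def
    proof (intro allI impI)
      fix U assume "neighbourhood powerset_topology y U"
      then obtain W where W: "openin powerset_topology W" "y \<in> W" "W \<subseteq> U"
        unfolding neighbourhood_def by auto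
      let ?B = "{s. shift m s x \<in> U \<and> shift m s y \<in> U}"
      have "?B \<in> p" using lim[OF W(1,2)] W(3) by (auto elim: ultrafilter_mono[OF p])
      then have B: "p \<in> basic_clopen ?B \<inter> delta m" using p pd by (simp add: basic_clopen_def)
      have op: "openin ?Y (basic_clopen ?B \<inter> delta m)"
        by (intro openin_subtopology_Int openin_basic_clopen)
      \<comment> \<open>The point \<open>p\<close> is in the closure of the smallest ideal, so its
        open neighbourhood meets the ideal itself.\<close>
      have "\<exists>q. q \<in> smallest_ideal m \<and> q \<in> basic_clopen ?B \<inter> delta m"
        using pK[unfolded in_closure_of, THEN conjunct2, rule_format, OF conjI[OF B op]] .
      then show "piecewise_syndetic m ?B" unfolding piecewise_syndetic_def by auto
    qed
  qed
qed

text \<open>Types cannot be quantified inside a formula. The equivalence is therefore stated for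
  phase spaces on \<open>'s set set\<close>, which hosts the shift, and the second conjunct gives
  the converse direction for an arbitrary point type \<open>'x\<close>.\<close>

theorem theorem5p10:
  fixes m :: "'s partial_op" and A :: "'s set"
  assumes "partial_semigroup m" and "commutative_op m" and "adequate m"
  shows
    "(quasi_central m A \<longleftrightarrow>
       (\<exists>(X :: 's set set topology) (T :: 's \<Rightarrow> 's set set \<Rightarrow> 's set set) x y U.
          dynamical_system m X T \<and> x \<in> topspace X \<and> y \<in> topspace X \<and>
          neighbourhood X y U \<and>
          jointly_intermittently_uniformly_recurrent m X T x y \<and>
          A = {s. T s x \<in> U})) \<and>
     ((\<exists>(X :: 'x topology) (T :: 's \<Rightarrow> 'x \<Rightarrow> 'x) x y U.
          dynamical_system m X T \<and> x \<in> topspace X \<and> y \<in> topspace X \<and>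
          neighbourhood X y U \<and>
          jointly_intermittently_uniformly_recurrent m X T x y \<and>
          A = {s. T s x \<in> U}) \<longrightarrow>
       quasi_central m A)"
proof (intro conjI iffI impI)
  assume "quasi_central m A"
  then obtain x y U where "neighbourhood powerset_topology y U"
    "jointly_intermittently_uniformly_recurrent m powerset_topology (shift m) x y"
    "A = {s. shift m s x \<in> U}"
    by (rule recurrent_if_quasi_central[OF assms(1)])
  then show "\<exists>(X :: 's set set topology) (T :: 's \<Rightarrow> 's set set \<Rightarrow> 's set set) x y U.
          dynamical_system m X T \<and> x \<in> topspace X \<and> y \<in> topspace X \<and>
          neighbourhood X y U \<and>
          jointly_intermittently_uniformly_recurrent m X T x y \<and>
          A = {s. T s x \<in> U}"
    using dynamical_system_shift[OF assms(1)]
    by (intro exI[of _ powerset_topology] exI[of _ "shift m"] exI[of _ x] exI[of _ y] exI[of _ U]) simp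
qed (elim exE conjE, hypsubst, rule quasi_central_if_recurrent[OF assms(1,3)]; assumption)+

end
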